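(* For every integer $n\geq 1$, the structure $(\mathcal{P}(\omega^n)/I_{\omega^n},\subseteq_n)$ is $\omega^n$-automatic.
   Context: $I_{\omega^n}=\{P\subseteq\omega^n\mid \mathrm{o.t.}(P)<\omega^n\}$ ($\mathrm{o.t.}$ = order type as a suborder of $(\omega^n,<)$), and $\mathcal{P}(\omega^n)/I_{\omega^n}$ is the quotient of $\mathcal{P}(\omega^n)$ by $A\approx_n B\iff A\triangle B\in I_{\omega^n}$. The almost-inclusion relation is $[A]\subseteq_n[B]$ iff $A\setminus B\in I_{\omega^n}$. An ordinal Büchi automaton is a tuple $(\Sigma,Q,q_0,\Delta,\gamma,F)$ (finite alphabet, finite states, initial state, successor transitions $\Delta\subseteq Q\times\Sigma\times Q$, limit transitions $\gamma\subseteq\mathcal{P}(Q)\times Q$, final states); a run on a word of length $\alpha$ starts in $q_0$, follows $\Delta$ at successor steps and at limit $i$ satisfies $(\mathrm{Inf}(x,i),x(i))\in\gamma$, $\mathrm{Inf}(x,i)$ being the set of states appearing cofinally below $i$; acceptance means some run ends in $F$. An $\omega^n$-automaton reads words of length $\omega^n$; relations are read as languages over product alphabets. A relational structure $\mathcal{M}=(M,(R_i)_{i\le k})$ is $\omega^n$-automatic if there are $\omega^n$-automata $\mathcal{A},\mathcal{A}_=,\mathcal{A}_1,\dots,\mathcal{A}_k$ and a surjection $h:L(\mathcal{A})\to M$ such that $\mathcal{A}_=$ accepts an equivalence $E$ on $L(\mathcal{A})$, each $\mathcal{A}_i$ accepts a relation $R_i'$ on $L(\mathcal{A})$ of the arity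 of $R_i$ compatible with $E$, and $h$ induces an isomorphism $(L(\mathcal{A}),(R_i'))/E\cong\mathcal{M}$. *)

theory Defs
  imports Main "HOL-Library.FuncSet"
begin

section \<open>The ordinals \<open>\<omega>\<^sup>n\<close> and \<open>\<alpha> + 1\<close>\<close>

text \<open>
  Ordinals are represented by well-orders in the sense of \<^const>\<open>Well_order\<close>, compared by
  \<^const>\<open>ordLess\<close>. The ordinal \<open>\<omega>\<^sup>n\<close> is the lexicographic order on \<open>n\<close>-tuples of natural numbers:
  the tuple \<open>[a\<^sub>1, \<dots>, a\<^sub>n]\<close> stands for \<open>\<omega>\<^bsup>n-1\<^esup> a\<^sub>1 + \<dots> + \<omega> a\<^bsub>n-1\<^esub> + a\<^sub>n\<close>.
\<close>

definition omega_pow :: "nat \<Rightarrow> nat list rel" where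
  "omega_pow n = lexn less_than n \<union> Id_on {xs. length xs = n}"

lemma Field_omega_pow: "Field (omega_pow n) = {xs. length xs = n}"
proof
  show "Field (omega_pow n) \<subseteq> {xs. length xs = n}"
    by (auto simp: Field_def omega_pow_def Domain_iff Range_iff lexn_length)
  show "{xs. length xs = n} \<subseteq> Field (omega_pow n)"
    by (auto simp: Field_def omega_pow_def Id_on_def)
qed

lemma omega_pow_0: "omega_pow 0 = {([], [])}"
  by (auto simp: omega_pow_def)

lemma omega_pow_Suc_iff:
  "(a # xs, b # ys) \<in> omega_pow (Suc n) \<longleftrightarrow>
     length xs = n \<and> length ys = n \<and> (a < b \<or> a = b \<and> (xs, ys) \<in> omega_pow n)"
  by (auto simp: omega_pow_def image_iff Bex_def dest: lexn_length)

lemma Well_order_omega_pow: "Well_order (omega_pow n)"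
proof -
  have wf: "wf (lexn less_than n)"
    by (rule wf_lexn) simp
  have "trans (lexn less_than n)"
    by (rule lexn_transI) (rule trans_less_than)
  then have trans: "trans (omega_pow n)"
    unfolding omega_pow_def trans_def by blast
  have antisym: "antisym (omega_pow n)"
    using wf unfolding omega_pow_def antisym_def by (auto dest: wf_asym)
  have total: "(xs, ys) \<in> omega_pow n \<or> (ys, xs) \<in> omega_pow n"
    if "length xs = n" "length ys = n" for xs ys
    using that
  proof (induction n arbitrary: xs ys)
    case 0
    then show ?case by (simp add: omega_pow_0)
  next
    case (Suc n)
    then obtain a xs' b ys' where "xs = a # xs'" "ys = b # ys'" "length xs' = n" "length ys' = n"
      by (metis length_Suc_conv)
    with Suc.IH[of xs' ys'] show ?case by (auto simp: omega_pow_Suc_iff)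
  qed
  have "wf (omega_pow n - Id)"
    by (rule wf_subset[OF wf]) (auto simp: omega_pow_def)
  moreover have "refl_on (Field (omega_pow n)) (omega_pow n)"
    unfolding Field_omega_pow by (auto simp: refl_on_def omega_pow_def)
  moreover have "omega_pow n \<subseteq> Field (omega_pow n) \<times> Field (omega_pow n)"
    by (auto simp: Field_def)
  ultimately show ?thesis
    using trans antisym total
    unfolding well_order_on_def linear_order_on_def partial_order_on_def preorder_on_def
      total_on_def
    by (simp add: Field_omega_pow)
qed

text \<open>If \<open>r\<close> represents \<open>\<alpha>\<close>, the following represents \<open>\<alpha> + 1\<close>; \<^const>\<open>None\<close> is the new greatest element.\<close>

definition ord_succ :: "'p rel \<Rightarrow> 'p option rel" where
  "ord_succ r = {(Some a, Some b) | a b. (a, b) \<in> r} \<union> {(i, None) | i. i \<in> insert None (Some ` Field r)}"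

definition is_zero :: "'p rel \<Rightarrow> 'p \<Rightarrow> bool" where
  "is_zero r i \<longleftrightarrow> i \<in> Field r \<and> underS r i = {}"

definition is_succ_of :: "'p rel \<Rightarrow> 'p \<Rightarrow> 'p \<Rightarrow> bool" where
  "is_succ_of r i j \<longleftrightarrow> i \<in> Field r \<and> j \<in> underS r i \<and> (\<forall>k \<in> underS r i. (k, j) \<in> r)"

definition is_limit :: "'p rel \<Rightarrow> 'p \<Rightarrow> bool" where
  "is_limit r i \<longleftrightarrow> i \<in> Field r \<and> \<not> is_zero r i \<and> \<not> (\<exists>j. is_succ_of r i j)"


section \<open>Ordinal Buechi automata\<close>

record ('a, 'q) ord_automaton =
  alphabet :: "'a set"
  states :: "'q set"
  initial :: 'q
  trans_succ :: "('q \<times> 'a \<times> 'q) set"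
  trans_lim :: "('q set \<times> 'q) set"
  final :: "'q set"

definition is_ord_automaton :: "('a, 'q) ord_automaton \<Rightarrow> bool" where
  "is_ord_automaton A \<longleftrightarrow>
     finite (alphabet A) \<and> finite (states A) \<and> initial A \<in> states A \<and>
     trans_succ A \<subseteq> states A \<times> alphabet A \<times> states A \<and>
     trans_lim A \<subseteq> Pow (states A) \<times> states A \<and>
     final A \<subseteq> states A"

definition words :: "'p rel \<Rightarrow> 'a set \<Rightarrow> ('p \<Rightarrow> 'a) set" where
  "words r \<Sigma> = (Field r \<rightarrow>\<^sub>E \<Sigma>)"

definition Inf_states :: "'p rel \<Rightarrow> ('p \<Rightarrow> 'q) \<Rightarrow> 'p \<Rightarrow> 'q set" where
  "Inf_states r x i = {q. \<forall>j \<in> underS r i. \<exists>k \<in> underS r i. (j, k) \<in> r \<and> x k = q}"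

text \<open>A run on a word of length \<open>\<alpha>\<close> is a sequence of states of length \<open>\<alpha> + 1\<close>.\<close>

definition is_run ::
  "'p rel \<Rightarrow> ('a, 'q) ord_automaton \<Rightarrow> ('p \<Rightarrow> 'a) \<Rightarrow> ('p option \<Rightarrow> 'q) \<Rightarrow> bool" where
  "is_run r A w x \<longleftrightarrow>
     (\<forall>i \<in> Field (ord_succ r). x i \<in> states A) \<and>
     (\<forall>i. is_zero (ord_succ r) i \<longrightarrow> x i = initial A) \<and>
     (\<forall>i p. is_succ_of (ord_succ r) i (Some p) \<longrightarrow> (x (Some p), w p, x i) \<in> trans_succ A) \<and>
     (\<forall>i. is_limit (ord_succ r) i \<longrightarrow> (Inf_states (ord_succ r) x i, x i) \<in> trans_lim A)"

definition accepts :: "'p rel \<Rightarrow> ('a, 'q) ord_automaton \<Rightarrow> ('p \<Rightarrow> 'a) \<Rightarrow> bool" where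
  "accepts r A w \<longleftrightarrow> (\<exists>x. is_run r A w x \<and> x None \<in> final A)"

definition language :: "'p rel \<Rightarrow> ('a, 'q) ord_automaton \<Rightarrow> ('p \<Rightarrow> 'a) set" where
  "language r A = {w \<in> words r (alphabet A). accepts r A w}"


section \<open>Relational structures\<close>

definition tuples :: "nat \<Rightarrow> 'm set \<Rightarrow> 'm list set" where
  "tuples m M = {xs. length xs = m \<and> set xs \<subseteq> M}"

text \<open>Each relation is paired with its arity.\<close>

record 'm rel_structure =
  universe :: "'m set"
  relations :: "(nat \<times> 'm list set) list"

definition is_structure :: "'m rel_structure \<Rightarrow> bool" where
  "is_structure M \<longleftrightarrow> (\<forall>(m, R) \<in> set (relations M). R \<subseteq> tuples m (universe M))"

definition compatible :: "'m rel \<Rightarrow> 'm list set \<Rightarrow> bool" where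
  "compatible E R \<longleftrightarrow>
     (\<forall>xs ys. xs \<in> R \<and> list_all2 (\<lambda>x y. (x, y) \<in> E) xs ys \<longrightarrow> ys \<in> R)"

definition quotient_structure :: "'m rel_structure \<Rightarrow> 'm rel \<Rightarrow> 'm set rel_structure" where
  "quotient_structure M E =
     \<lparr> universe = universe M // E,
       relations = map (\<lambda>(m, R). (m, map (\<lambda>x. E `` {x}) ` R)) (relations M) \<rparr>"

definition is_isomorphism :: "('m \<Rightarrow> 'l) \<Rightarrow> 'm rel_structure \<Rightarrow> 'l rel_structure \<Rightarrow> bool" where
  "is_isomorphism g M N \<longleftrightarrow>
     bij_betw g (universe M) (universe N) \<and>
     list_all2 (\<lambda>(m, R) (m', S). m = m' \<and> (\<forall>xs \<in> tuples m (universe M). xs \<in> R \<longleftrightarrow> map g xs \<in> S))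
       (relations M) (relations N)"


section \<open>Automatic structures\<close>

text \<open>A tuple of words is read as a single word over the product alphabet.\<close>

definition convolution :: "'p rel \<Rightarrow> ('p \<Rightarrow> 'a) list \<Rightarrow> 'p \<Rightarrow> 'a list" where
  "convolution r ws = (\<lambda>p \<in> Field r. map (\<lambda>w. w p) ws)"

definition recognizes ::
  "'p rel \<Rightarrow> 'a set \<Rightarrow> nat \<Rightarrow> ('a list, 'q) ord_automaton \<Rightarrow> ('p \<Rightarrow> 'a) list set \<Rightarrow> bool" where
  "recognizes r \<Sigma> m A R \<longleftrightarrow>
     is_ord_automaton A \<and> alphabet A = tuples m \<Sigma> \<and>
     R \<subseteq> tuples m (words r \<Sigma>) \<and> language r A = convolution r ` R"

text \<open>
  Alphabets and state sets are finite, so there is no loss of generality in taking their elements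
  to be natural numbers.
\<close>

definition automatic :: "'p rel \<Rightarrow> 'm rel_structure \<Rightarrow> bool" where
  "automatic r M \<longleftrightarrow> is_structure M \<and>
     (\<exists>(A :: (nat, nat) ord_automaton) (A_eq :: (nat list, nat) ord_automaton)
        (As :: (nat list, nat) ord_automaton list)
        (h :: ('p \<Rightarrow> nat) \<Rightarrow> 'm) E Rs g.
        is_ord_automaton A \<and>
        h ` language r A = universe M \<and>
        equiv (language r A) E \<and>
        recognizes r (alphabet A) 2 A_eq {[u, v] | u v. (u, v) \<in> E} \<and>
        is_structure \<lparr> universe = language r A, relations = Rs \<rparr> \<and>
        list_all2 (\<lambda>B (m, R). recognizes r (alphabet A) m B R \<and> compatible E R) As Rs \<and>
        is_isomorphism g
          (quotient_structure \<lparr> universe = language r A, relations = Rs \<rparr> E) M \<and>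
        (\<forall>w \<in> language r A. g (E `` {w}) = h w))"

definition omega_pow_automatic :: "nat \<Rightarrow> 'm rel_structure \<Rightarrow> bool" where
  "omega_pow_automatic n M \<longleftrightarrow> automatic (omega_pow n) M"


section \<open>The structure \<open>(\<P>(\<omega>\<^sup>n)/I, \<subseteq>\<^sub>n)\<close>\<close>

definition I_omega :: "nat \<Rightarrow> nat list set set" where
  "I_omega n = {P. P \<subseteq> Field (omega_pow n) \<and> (Restr (omega_pow n) P, omega_pow n) \<in> ordLess}"

definition approx_omega :: "nat \<Rightarrow> nat list set rel" where
  "approx_omega n =
     {(A, B). A \<subseteq> Field (omega_pow n) \<and> B \<subseteq> Field (omega_pow n) \<and> (A - B) \<union> (B - A) \<in> I_omega n}"

definition almost_subset :: "nat \<Rightarrow> nat list set set list set" where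
  "almost_subset n =
     {[approx_omega n `` {A}, approx_omega n `` {B}] | A B.
        A \<subseteq> Field (omega_pow n) \<and> B \<subseteq> Field (omega_pow n) \<and> A - B \<in> I_omega n}"

definition power_quotient :: "nat \<Rightarrow> nat list set set rel_structure" where
  "power_quotient n =
     \<lparr> universe = Pow (Field (omega_pow n)) // approx_omega n,
       relations = [(2, almost_subset n)] \<rparr>"

end

theory Submission
  imports Defs "HOL-Library.Infinite_Set"
begin

text \<open>
  A set \<open>P \<subseteq> \<omega>\<^bsup>n+1\<^esup>\<close> has order type \<open>\<omega>\<^bsup>n+1\<^esup>\<close> iff infinitely many of its \<open>\<omega>\<^bsup>n\<^esup>\<close>-blocks have order
  type \<open>\<omega>\<^bsup>n\<^esup>\<close>; call such sets full. This recursion can be checked by a deterministic automaton with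
  states \<open>0, \<dots>, 2n + 1\<close>: after a position of the form \<open>\<beta> + \<omega>\<^bsup>j\<^esup>\<close> it is in state \<open>2j + 1\<close> or \<open>2j\<close>,
  according to whether the preceding block of length \<open>\<omega>\<^bsup>j\<^esup>\<close> is full or not. At a limit ending a block
  of length \<open>\<omega>\<^bsup>j+1\<^esup>\<close>, the largest state seen cofinally is \<open>2j + 1\<close> if infinitely many of the
  \<open>\<omega>\<^bsup>j\<^esup>\<close>-blocks are full and \<open>2j\<close> otherwise, so the limit transition sends \<open>S\<close> to \<open>Max S + 2\<close>.
  Subsets of \<open>\<omega>\<^bsup>n\<^esup>\<close> are coded by their characteristic words, and both relations
  to be recognised say that a set read off letterwise from two such words is not full.
\<close>

section \<open>Sets of full order type\<close>

fun full :: "nat \<Rightarrow> nat list set \<Rightarrow> bool" where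
  "full 0 P \<longleftrightarrow> [] \<in> P"
| "full (Suc n) P \<longleftrightarrow> infinite {a. full n {xs. a # xs \<in> P}}"

lemma full_mono: "full n P \<Longrightarrow> P \<subseteq> Q \<Longrightarrow> full n Q"
proof (induction n arbitrary: P Q)
  case (Suc n)
  have "{a. full n {xs. a # xs \<in> P}} \<subseteq> {a. full n {xs. a # xs \<in> Q}}"
    using Suc.IH Suc.prems(2) by (smt (verit) Collect_mono subset_iff)
  then show ?case
    using Suc.prems(1) by (auto dest: finite_subset)
qed auto

text \<open>Taking sections commutes with unions, and a union of two sets of naturals is infinite
  iff one of them is. Closure of the non-full sets under unions is what makes
  \<open>approx_omega\<close> transitive.\<close>

lemma full_Un: "full n (P \<union> Q) \<longleftrightarrow> full n P \<or> full n Q"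
proof (induction n arbitrary: P Q)
  case (Suc n)
  have "{a. full n {xs. a # xs \<in> P \<union> Q}} =
    {a. full n {xs. a # xs \<in> P}} \<union> {a. full n {xs. a # xs \<in> Q}}"
    using Suc.IH[of "{xs. _ # xs \<in> P}" "{xs. _ # xs \<in> Q}"]
    by (simp add: set_eq_iff Collect_disj_eq)
  then show ?case
    by simp
qed auto

lemma not_full_empty: "\<not> full n {}"
  by (induction n) auto

section \<open>Strictly increasing self-maps of \<open>\<omega>\<^sup>n\<close>\<close>

text \<open>Unlike for \<open>embed\<close>, the image need not be an initial segment. Lists of
  other lengths may lie in \<open>P\<close>, so \<open>P\<close> can be \<open>UNIV\<close>.\<close>

definition embeds :: "nat \<Rightarrow> (nat list \<Rightarrow> nat list) \<Rightarrow> nat list set \<Rightarrow> bool" where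
  "embeds n f P \<longleftrightarrow> (\<forall>x. length x = n \<longrightarrow> f x \<in> P \<and> length (f x) = n) \<and>
     (\<forall>x y. (x, y) \<in> omega_pow n \<and> x \<noteq> y \<longrightarrow> (f x, f y) \<in> omega_pow n \<and> f x \<noteq> f y)"

lemma omega_pow_length: "(x, y) \<in> omega_pow n \<Longrightarrow> length x = n \<and> length y = n"
  by (auto simp: omega_pow_def dest: lexn_length)

lemma omega_pow_refl: "length x = n \<Longrightarrow> (x, x) \<in> omega_pow n"
  by (auto simp: omega_pow_def)

lemma omega_pow_trans: "(x, y) \<in> omega_pow n \<Longrightarrow> (y, z) \<in> omega_pow n \<Longrightarrow> (x, z) \<in> omega_pow n"
  using Well_order_omega_pow[of n] unfolding order_on_defs trans_def by blast

lemma omega_pow_antisym: "(x, y) \<in> omega_pow n \<Longrightarrow> (y, x) \<in> omega_pow n \<Longrightarrow> x = y"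
  using Well_order_omega_pow[of n] unfolding order_on_defs antisym_def by blast

lemma omega_pow_total:
  "length x = n \<Longrightarrow> length y = n \<Longrightarrow> (x, y) \<in> omega_pow n \<or> (y, x) \<in> omega_pow n"
  using Well_order_omega_pow[of n] omega_pow_refl[of x n]
  by (cases "x = y") (simp_all add: order_on_defs total_on_def Field_omega_pow)

lemma wf_omega_pow: "wf (omega_pow n - Id)"
  using Well_order_omega_pow[of n] unfolding order_on_defs by blast

lemma zeros_least: "length x = n \<Longrightarrow> (replicate n 0, x) \<in> omega_pow n"
proof (induction n arbitrary: x)
  case (Suc n)
  then show ?case
    by (cases x) (auto simp: omega_pow_Suc_iff)
qed (simp add: omega_pow_0)

text \<open>If \<open>f x\<close> lay strictly below \<open>x\<close>, the induction hypothesis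
  would put \<open>f x\<close> at or below \<open>f (f x)\<close>, whereas monotonicity puts
  \<open>f (f x)\<close> strictly below \<open>f x\<close>.\<close>

lemma embeds_inflationary:
  assumes "embeds n f P" "length x = n"
  shows "(x, f x) \<in> omega_pow n"
  using assms(2)
proof (induction x rule: wf_induct_rule[OF wf_omega_pow[of n]])
  case (1 x)
  show ?case
  proof (rule ccontr)
    assume "(x, f x) \<notin> omega_pow n"
    moreover have len: "length (f x) = n"
      using assms(1) 1(2) by (simp add: embeds_def)
    ultimately have less: "(f x, x) \<in> omega_pow n" "f x \<noteq> x"
      using omega_pow_total[OF 1(2) len] omega_pow_refl[OF 1(2)] by auto
    then have "(f x, f (f x)) \<in> omega_pow n"
      using 1(1)[of "f x"] len by simp
    moreover have "(f (f x), f x) \<in> omega_pow n" "f (f x) \<noteq> f x"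
      using assms(1) less by (simp_all add: embeds_def)
    ultimately show False
      using omega_pow_antisym by metis
  qed
qed

text \<open>The \<open>k\<close>-th block goes into the \<open>k\<close>-th full section, counted in
  increasing order by \<open>enumerate\<close>, along an embedding from the induction
  hypothesis.\<close>

lemma full_imp_embeds: "full n P \<Longrightarrow> \<exists>f. embeds n f P"
proof (induction n arbitrary: P)
  case 0
  then show ?case
    by (intro exI[of _ id]) (auto simp: embeds_def omega_pow_0)
next
  case (Suc n)
  define S where "S = {a. full n {xs. a # xs \<in> P}}"
  have inf: "infinite S"
    using Suc.prems by (simp add: S_def)
  have "\<forall>a\<in>S. \<exists>f. embeds n f {xs. a # xs \<in> P}"
    using Suc.IH by (simp add: S_def)
  then obtain F where F: "\<And>a. a \<in> S \<Longrightarrow> embeds n (F a) {xs. a # xs \<in> P}"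
    by metis
  let ?e = "enumerate S"
  have eS: "?e k \<in> S" for k
    using enumerate_in_set inf by blast
  have mono: "?e k < ?e l" if "k < l" for k l
    using enumerate_mono[OF that inf] .
  define f where "f x = ?e (hd x) # F (?e (hd x)) (tl x)" for x
  have "embeds (Suc n) f P"
    unfolding embeds_def
  proof (intro conjI allI impI; (elim conjE)?)
    fix x :: "nat list"
    assume "length x = Suc n"
    then show "f x \<in> P" "length (f x) = Suc n"
      using F[OF eS, of "hd x"] unfolding embeds_def f_def by auto
  next
    fix x y
    assume xy: "(x, y) \<in> omega_pow (Suc n)" "x \<noteq> y"
    then obtain a xs b ys where eq: "x = a # xs" "y = b # ys"
      using omega_pow_length[OF xy(1)] by (cases x; cases y) auto
    have F': "embeds n (F (?e c)) {xs. ?e c # xs \<in> P}" for c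
      using F eS by blast
    show "(f x, f y) \<in> omega_pow (Suc n)" "f x \<noteq> f y"
      using xy F'[of a] F'[of b] mono[of a b] unfolding embeds_def eq f_def
      by (auto simp: omega_pow_Suc_iff)
  qed
  then show ?case
    by blast
qed

lemma embeds_imp_full: "embeds n f P \<Longrightarrow> full n P"
proof (induction n arbitrary: f P)
  case 0
  then show ?case
    by (auto simp: embeds_def)
next
  case (Suc n)
  have len: "length (f x) = Suc n" and inP: "f x \<in> P" if "length x = Suc n" for x
    using Suc.prems that by (auto simp: embeds_def)
  have strict: "(f x, f y) \<in> omega_pow (Suc n) \<and> f x \<noteq> f y"
    if "(x, y) \<in> omega_pow (Suc n)" "x \<noteq> y" for x y
    using Suc.prems that by (auto simp: embeds_def)
  have hd_mono: "hd x \<le> hd y" if "(x, y) \<in> omega_pow (Suc n)" for x y :: "nat list"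
    using that omega_pow_length[OF that] by (cases x; cases y) (auto simp: omega_pow_Suc_iff)
  have "\<exists>c\<ge>k. full n {xs. c # xs \<in> P}" for k
  proof -
    \<comment> \<open>On the \<open>k\<close>-th block the leading coordinate of \<open>f\<close> is monotone and bounded, hence eventually a
      constant \<open>c\<close>; so \<open>f\<close> embeds a tail of that block, a copy of \<open>\<omega>\<^bsup>n\<^esup>\<close>, into the section at \<open>c\<close>.\<close>
    let ?H = "{hd (f (k # xs)) | xs. length xs = n}"
    \<comment> \<open>The first point of the next block bounds the image of the \<open>k\<close>-th
      block.\<close>
    have "hd (f (k # xs)) \<le> hd (f (Suc k # replicate n 0))" if "length xs = n" for xs
      using that by (intro hd_mono strict[THEN conjunct1]) (simp_all add: omega_pow_Suc_iff)
    then have ub: "\<forall>h\<in>?H. h \<le> hd (f (Suc k # replicate n 0))"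
      by blast
    then have fin: "finite ?H"
      by (meson finite_nat_set_iff_bounded_le)
    have ne: "?H \<noteq> {}"
      using Ex_list_of_length by blast
    define c where "c = Max ?H"
    obtain xs0 where xs0: "length xs0 = n" "hd (f (k # xs0)) = c"
      using Max_in[OF fin ne] unfolding c_def by (smt (verit) mem_Collect_eq)
    have const: "hd (f (k # xs)) = c" if "(xs0, xs) \<in> omega_pow n" for xs
    proof (rule antisym)
      have "hd (f (k # xs)) \<in> ?H"
        using omega_pow_length[OF that] by blast
      then show "hd (f (k # xs)) \<le> c"
        unfolding c_def using Max_ge[OF fin] by blast
      show "c \<le> hd (f (k # xs))"
      proof (cases "xs = xs0")
        case False
        then show ?thesis
          unfolding xs0(2)[symmetric]
          using that omega_pow_length[OF that]
          by (intro hd_mono strict[THEN conjunct1]) (simp_all add: omega_pow_Suc_iff)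
      qed (simp add: xs0)
    qed
    \<comment> \<open>Pushing the leading coordinate past that of \<open>xs0\<close> gives a
      strictly increasing map into the tail from \<open>xs0\<close> on; for \<open>n = 0\<close> it
      fixes the only tuple.\<close>
    define s where "s xs = (case xs of [] \<Rightarrow> [] | a # ys \<Rightarrow> (Suc (hd xs0) + a) # ys)" for xs
    have s: "(xs0, s xs) \<in> omega_pow n" if len_xs: "length xs = n" for xs
    proof (cases xs)
      case Nil
      then show ?thesis
        using len_xs xs0(1) by (auto simp: s_def omega_pow_0)
    next
      case (Cons a ys)
      then obtain b zs where "xs0 = b # zs"
        using len_xs xs0(1) by (cases xs0) auto
      then show ?thesis
        using len_xs xs0(1) Cons by (cases n) (auto simp: s_def omega_pow_Suc_iff)
    qed
    have s_strict: "(s xs, s ys) \<in> omega_pow n \<and> s xs \<noteq> s ys"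
      if "(xs, ys) \<in> omega_pow n" "xs \<noteq> ys" for xs ys
      using that omega_pow_length[OF that(1)]
      by (cases n; cases xs; cases ys) (auto simp: s_def omega_pow_Suc_iff)
    have f_eq: "f (k # s xs) = c # tl (f (k # s xs))" if "length xs = n" for xs
      using const[OF s[OF that]] len[of "k # s xs"] omega_pow_length[OF s[OF that]]
      by (cases "f (k # s xs)") auto
    have "embeds n (\<lambda>xs. tl (f (k # s xs))) {xs. c # xs \<in> P}"
      unfolding embeds_def
    proof (intro conjI allI impI; (elim conjE)?)
      fix xs :: "nat list"
      assume xs: "length xs = n"
      then have l: "length (k # s xs) = Suc n"
        using omega_pow_length[OF s[OF xs]] by simp
      show "tl (f (k # s xs)) \<in> {xs. c # xs \<in> P}"
        using inP[OF l] f_eq[OF xs] by simp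
      show "length (tl (f (k # s xs))) = n"
        using len[OF l] by simp
    next
      fix xs ys
      assume xy: "(xs, ys) \<in> omega_pow n" "xs \<noteq> ys"
      then have l: "length xs = n" "length ys = n"
        using omega_pow_length by blast+
      have "(f (k # s xs), f (k # s ys)) \<in> omega_pow (Suc n) \<and> f (k # s xs) \<noteq> f (k # s ys)"
        using s_strict[OF xy] omega_pow_length[of "s xs" "s ys" n]
        by (intro strict) (auto simp: omega_pow_Suc_iff)
      then show "(tl (f (k # s xs)), tl (f (k # s ys))) \<in> omega_pow n"
        "tl (f (k # s xs)) \<noteq> tl (f (k # s ys))"
        using f_eq[OF l(1)] f_eq[OF l(2)] by (metis less_irrefl omega_pow_Suc_iff)+
    qed
    then have "full n {xs. c # xs \<in> P}"
      by (rule Suc.IH)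
    \<comment> \<open>An increasing self-map moves no point down, so \<open>k # xs0\<close> is sent
      to a tuple with leading coordinate at least \<open>k\<close>.\<close>
    moreover have "k \<le> c"
      using hd_mono[OF embeds_inflationary[OF Suc.prems, of "k # xs0"]] xs0 by simp
    ultimately show ?thesis
      by blast
  qed
  then show ?case
    by (simp add: infinite_nat_iff_unbounded_le)
qed

text \<open>Well-orders are comparable, so an order type not below \<open>\<omega>\<^sup>n\<close>
  yields an embedding of \<open>\<omega>\<^sup>n\<close> into \<open>P\<close>. If the order type is
  smaller, such an embedding would compose to an increasing self-map of
  \<open>\<omega>\<^sup>n\<close> with bounded image.\<close>

lemma I_omega_iff:
  assumes P: "P \<subseteq> Field (omega_pow n)"
  shows "P \<in> I_omega n \<longleftrightarrow> \<not> full n P"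
proof -
  let ?r = "omega_pow n" and ?s = "Restr (omega_pow n) P"
  have wo: "Well_order ?r" "Well_order ?s"
    using Well_order_omega_pow Well_order_Restr by blast+
  have Fs: "Field ?s = P"
  proof
    show "P \<subseteq> Field ?s"
    proof
      fix x
      assume "x \<in> P"
      then have "(x, x) \<in> ?s"
        using P omega_pow_refl by (auto simp: Field_omega_pow)
      then show "x \<in> Field ?s"
        by (rule FieldI1)
    qed
  qed (auto simp: Field_def)
  have "\<exists>f. embeds n f P" if not_less: "(?s, ?r) \<notin> ordLess"
  proof -
    have "(?r, ?s) \<in> ordLeq"
      using not_less not_ordLess_iff_ordLeq wo by blast
    then obtain f where f: "embed ?r ?s f"
      unfolding ordLeq_def by blast
    have "inj_on f (Field ?r)" "compat ?r ?s f" "f ` Field ?r \<subseteq> P"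
      using embed_inj_on[OF wo(1) f] embed_compat[OF f] embed_Field[OF f] Fs by auto
    then have "embeds n f P"
      using P unfolding embeds_def compat_def inj_on_def Field_omega_pow
      by (auto dest: omega_pow_length)
    then show ?thesis
      by blast
  qed
  moreover have "\<not> embeds n f P" if less: "(?s, ?r) \<in> ordLess" for f
  proof
    assume f: "embeds n f P"
    obtain g where g: "embedS ?s ?r g"
      using less unfolding ordLess_def by blast
    then have emb: "embed ?s ?r g"
      by (simp add: embedS_def)
    \<comment> \<open>A proper embedding has a proper initial segment as image, hence exactly the
      points below some \<open>a\<close>.\<close>
    obtain a where a: "a \<in> Field ?r" "g ` Field ?s = underS ?r a"
      using embedS_iff[OF wo(2) emb] g embed_Field_ofilter[OF wo(2) wo(1) emb]
        wo_rel.ofilter_underS_Field[of ?r "g ` Field ?s"] wo(1)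
      unfolding wo_rel_def by blast
    have "inj_on g P" "compat ?s ?r g"
      using embed_inj_on[OF wo(2) emb] embed_compat[OF emb] Fs by auto
    moreover have "length (g x) = n" if "x \<in> P" for x
      using embed_Field[OF emb] that unfolding Fs by (auto simp: Field_omega_pow)
    \<comment> \<open>Only monotonicity of the composition matters, so the target is
      \<open>UNIV\<close>. It sends \<open>a\<close> below itself, against
      \<open>embeds_inflationary\<close>.\<close>
    ultimately have "embeds n (g \<circ> f) UNIV"
      using f unfolding embeds_def compat_def inj_on_def
      by (auto dest: omega_pow_length) (metis omega_pow_length)+
    then have "(a, g (f a)) \<in> ?r"
      using embeds_inflationary[of n "g \<circ> f" UNIV a] a(1) by (simp add: Field_omega_pow)
    moreover have "g (f a) \<in> underS ?r a"
      using f a unfolding embeds_def Fs by (auto simp: Field_omega_pow)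
    ultimately show False
      using omega_pow_antisym by (auto simp: underS_def)
  qed
  ultimately show ?thesis
    using P full_imp_embeds embeds_imp_full unfolding I_omega_def by blast
qed

section \<open>An automaton deciding fullness\<close>

text \<open>
  The state reached at position \<open>xs\<close> when \<open>P\<close> is the set of marked positions. Position \<open>0\<close> gets the
  initial state \<open>0\<close>; otherwise the number of trailing zeros of \<open>xs\<close> is the \<open>j\<close> with \<open>xs = \<beta> + \<omega>\<^bsup>j\<^esup>\<close>.
\<close>

fun state_at :: "nat list set \<Rightarrow> nat list \<Rightarrow> nat" where
  "state_at P [] = 0"
| "state_at P (a # xs) =
    (if xs = replicate (length xs) 0
     then (case a of 0 \<Rightarrow> 0
           | Suc c \<Rightarrow> 2 * length xs + of_bool (full (length xs) {zs. c # zs \<in> P}))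
     else state_at {zs. a # zs \<in> P} xs)"

lemma state_at_zeros: "state_at P (replicate n 0) = 0"
  by (cases n) auto

text \<open>Fewer than \<open>length xs\<close> zeros follow the last nonzero entry. Hence a nonzero
  tail of length \<open>m\<close> never produces the states \<open>2 * m\<close> or
  \<open>2 * m + 1\<close>.\<close>

lemma state_at_less: "xs \<noteq> [] \<Longrightarrow> state_at P xs < 2 * length xs"
proof (induction xs arbitrary: P)
  case (Cons a xs)
  show ?case
  proof (cases "xs = replicate (length xs) 0")
    case True
    then show ?thesis
      by (simp split: nat.split)
  next
    case False
    then have "xs \<noteq> []"
      by auto
    from Cons.IH[OF this, of "{zs. a # zs \<in> P}"] False show ?thesis
      by simp
  qed
qed simp

text \<open>Only the last nonzero entry, the zeros after it and a section of \<open>P\<close>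
  matter, so a prefix of a nonzero tail merely selects a section.\<close>

lemma state_at_append:
  assumes "xs \<noteq> replicate (length xs) 0"
  shows "state_at P (us @ xs) = state_at {zs. us @ zs \<in> P} xs"
proof (induction us arbitrary: P)
  case (Cons a us)
  have "us @ xs \<noteq> replicate (length (us @ xs)) 0"
    using assms by (auto simp: replicate_add)
  then show ?case
    using Cons.IH[of "{zs. a # zs \<in> P}"] by simp
qed simp

lemma state_at_decomposed:
  "state_at P (ys @ Suc c # replicate j 0) = 2 * j + of_bool (full j {zs. ys @ c # zs \<in> P})"
  using state_at_append[of "Suc c # replicate j 0" P ys] by simp

text \<open>The split is at the last nonzero entry \<open>Suc c\<close>; the block that ends there
  is the one with prefix \<open>ys @ [c]\<close>.\<close>

lemma zeros_or_decomposed: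
  fixes xs :: "nat list"
  obtains "xs = replicate (length xs) 0" | ys c j where "xs = ys @ Suc c # replicate j 0"
proof (induction xs arbitrary: thesis)
  case (Cons a xs)
  show ?case
  proof (rule Cons.IH)
    assume zeros: "xs = replicate (length xs) 0"
    show thesis
    proof (cases a)
      case 0
      with zeros show ?thesis
        by (intro Cons.prems(1)) simp
    next
      case (Suc c)
      with zeros show ?thesis
        by (intro Cons.prems(2)[of "[]" c "length xs"]) simp
    qed
  next
    fix ys c j
    assume "xs = ys @ Suc c # replicate j 0"
    then show thesis
      by (intro Cons.prems(2)[of "a # ys" c j]) simp
  qed
qed simp

text \<open>\<open>T\<close> is what a limit transition sees at the end of the block with prefix
  \<open>us\<close>: the states met in infinitely many subblocks. The verdict on subblock
  \<open>c\<close> is stored at the first position of subblock \<open>Suc c\<close>.\<close>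

lemma block_states:
  fixes m P us
  defines "T \<equiv> {q. infinite {a. \<exists>zs. length zs = m \<and> state_at P (us @ a # zs) = q}}"
  shows "T \<noteq> {}" "Max T = 2 * m + of_bool (full (Suc m) {zs. us @ zs \<in> P})"
    "\<And>q. q \<in> T \<Longrightarrow> q \<le> 2 * m + 1"
proof -
  define Q where "Q = {zs. us @ zs \<in> P}"
  have shift: "state_at P (us @ Suc c # zs) = state_at Q (Suc c # zs)" for c zs
    using state_at_append[of "Suc c # zs" P us] by (simp add: Q_def)
  show bound: "q \<le> 2 * m + 1" if q: "q \<in> T" for q
  proof -
    \<comment> \<open>Subblock \<open>0\<close> is avoided: its first position may report on an
      earlier, longer block and so exceed the bound.\<close>
    obtain a where a: "a \<ge> 1" "a \<in> {a. \<exists>zs. length zs = m \<and> state_at P (us @ a # zs) = q}"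
      using q unfolding T_def mem_Collect_eq infinite_nat_iff_unbounded_le by blast
    then obtain c zs where "length zs = m" "state_at P (us @ Suc c # zs) = q"
      by (cases a) auto
    then show ?thesis
      using state_at_less[of "Suc c # zs" Q] unfolding shift by simp
  qed
  then have fin: "finite T"
    by (meson finite_nat_set_iff_bounded_le)
  let ?G = "{c. full m {zs. c # zs \<in> Q}}"
  have top: "state_at P (us @ Suc c # replicate m 0) = 2 * m + of_bool (c \<in> ?G)" for c
    by (simp add: shift)
  have "2 * m + of_bool (full (Suc m) Q) \<in> T \<and>
    (\<forall>q\<in>T. q \<le> 2 * m + of_bool (full (Suc m) Q))"
  proof (cases "full (Suc m) Q")
    case True
    have "Suc ` ?G \<subseteq> {a. \<exists>zs. length zs = m \<and> state_at P (us @ a # zs) = 2 * m + 1}"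
      using top by (auto intro!: exI[of _ "replicate m 0"])
    moreover have "infinite (Suc ` ?G)"
      using True by (simp add: finite_image_iff)
    ultimately have "2 * m + 1 \<in> T"
      unfolding T_def using finite_subset by blast
    then show ?thesis
      using True bound by simp
  next
    case False
    then have finG: "finite ?G"
      by simp
    have "Suc ` (- ?G) \<subseteq> {a. \<exists>zs. length zs = m \<and> state_at P (us @ a # zs) = 2 * m}"
      using top by (auto intro!: exI[of _ "replicate m 0"])
    moreover have "infinite (Suc ` (- ?G))"
      using finG by (simp add: finite_image_iff)
    ultimately have "2 * m \<in> T"
      unfolding T_def using finite_subset by blast
    moreover have "2 * m + 1 \<notin> T"
    proof -
      \<comment> \<open>In subblock \<open>Suc c\<close> only the first position can carry
        \<open>2 * m + 1\<close>, and then section \<open>c\<close> is full. Subblock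
        \<open>0\<close> may carry it for other reasons.\<close>
      have "a = 0 \<or> a \<in> Suc ` ?G"
        if "length zs = m" "state_at P (us @ a # zs) = 2 * m + 1" for a zs
      proof (cases a)
        case (Suc c)
        have eq: "state_at Q (Suc c # zs) = 2 * m + 1"
          using that(2) Suc shift by simp
        have "zs = replicate m 0"
        proof (rule ccontr)
          assume nz: "zs \<noteq> replicate m 0"
          then have "zs \<noteq> []"
            using that(1) by auto
          with eq nz show False
            using state_at_less[of zs "{zs. Suc c # zs \<in> Q}"] that(1) by simp
        qed
        then have "c \<in> ?G"
          using eq by (simp add: of_bool_def split: if_splits)
        then show ?thesis
          using Suc by blast
      qed simp
      then have "{a. \<exists>zs. length zs = m \<and> state_at P (us @ a # zs) = 2 * m + 1}
          \<subseteq> insert 0 (Suc ` ?G)"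
        by blast
      moreover have "finite (insert 0 (Suc ` ?G))"
        using finG by simp
      ultimately show ?thesis
        unfolding T_def using finite_subset by blast
    qed
    ultimately show ?thesis
      using False bound by (fastforce simp: le_Suc_eq)
  qed
  then show "T \<noteq> {}" "Max T = 2 * m + of_bool (full (Suc m) {zs. us @ zs \<in> P})"
    using fin unfolding Q_def by (auto intro!: Max_eqI)
qed

section \<open>Positions including the end, and uniqueness of runs\<close>

lemma ord_succ_iff [simp]:
  "(Some a, Some b) \<in> ord_succ r \<longleftrightarrow> (a, b) \<in> r"
  "(Some a, None) \<in> ord_succ r \<longleftrightarrow> a \<in> Field r"
  "(None, Some b) \<notin> ord_succ r"
  by (auto simp: ord_succ_def)

lemma underS_ord_succ:
  "underS (ord_succ r) (Some p) = Some ` underS r p"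
  "underS (ord_succ r) None = Some ` Field r"
  by (auto simp: underS_def ord_succ_def)

lemma Field_ord_succ: "Field (ord_succ r) = insert None (Some ` Field r)"
proof
  show "insert None (Some ` Field r) \<subseteq> Field (ord_succ r)"
    by (auto intro: FieldI1[of _ None] FieldI2[of None None] simp: ord_succ_def)
qed (auto simp: ord_succ_def Field_def)

text \<open>Every position is zero, a successor or a limit, and in each case \<open>is_run\<close>
  constrains its state through states at smaller positions only.\<close>

lemma is_run_step_unique:
  assumes runs: "is_run r A w x" "is_run r A w y"
    and det_succ: "\<And>q a p p'. (q, a, p) \<in> trans_succ A \<Longrightarrow> (q, a, p') \<in> trans_succ A \<Longrightarrow> p = p'"
    and det_lim: "\<And>S p p'. (S, p) \<in> trans_lim A \<Longrightarrow> (S, p') \<in> trans_lim A \<Longrightarrow> p = p'"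
    and i: "i \<in> Field (ord_succ r)"
    and eq: "\<And>k. k \<in> underS (ord_succ r) i \<Longrightarrow> x k = y k"
  shows "x i = y i"
proof -
  consider "is_zero (ord_succ r) i" | j where "is_succ_of (ord_succ r) i j" | "is_limit (ord_succ r) i"
    using i unfolding is_limit_def by blast
  then show ?thesis
  proof cases
    case 1
    then show ?thesis
      using runs by (simp add: is_run_def)
  next
    case (2 j)
    then have j: "j \<in> underS (ord_succ r) i"
      by (simp add: is_succ_of_def)
    then obtain p where p: "j = Some p"
      by (cases i) (auto simp: underS_ord_succ)
    have "(x j, w p, x i) \<in> trans_succ A" "(y j, w p, y i) \<in> trans_succ A"
      using runs 2 unfolding is_run_def p by blast+
    then show ?thesis
      using eq[OF j] det_succ by metis
  next
    case 3
    have "Inf_states (ord_succ r) x i = Inf_states (ord_succ r) y i"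
      unfolding Inf_states_def using eq by (metis (no_types, lifting))
    then show ?thesis
      using runs 3 det_lim unfolding is_run_def by metis
  qed
qed

text \<open>Well-founded induction along \<open>r\<close>, then one more step for the end position
  \<open>None\<close>.\<close>

lemma is_run_unique:
  assumes wo: "Well_order r"
    and runs: "is_run r A w x" "is_run r A w y"
    and det_succ: "\<And>q a p p'. (q, a, p) \<in> trans_succ A \<Longrightarrow> (q, a, p') \<in> trans_succ A \<Longrightarrow> p = p'"
    and det_lim: "\<And>S p p'. (S, p) \<in> trans_lim A \<Longrightarrow> (S, p') \<in> trans_lim A \<Longrightarrow> p = p'"
  shows "x None = y None"
proof -
  note step = is_run_step_unique[OF runs det_succ det_lim]
  have wf: "wf (r - Id)"
    using wo by (simp add: order_on_defs)
  have "x (Some p) = y (Some p)" if "p \<in> Field r" for p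
    using that
  proof (induction p rule: wf_induct_rule[OF wf])
    case (1 p)
    show ?case
    proof (rule step)
      fix k
      assume "k \<in> underS (ord_succ r) (Some p)"
      then obtain q where "k = Some q" "(q, p) \<in> r - Id" "q \<in> Field r"
        unfolding underS_ord_succ by (auto simp: underS_def intro: FieldI1)
      then show "x k = y k"
        using 1(1) by blast
    qed (use 1(2) in \<open>simp_all add: Field_ord_succ\<close>)
  qed
  note Some_eq = this
  show ?thesis
    by (rule step) (auto simp: Field_ord_succ underS_ord_succ Some_eq)
qed

section \<open>Blocks of \<open>\<omega>\<^sup>n\<close> and their suprema\<close>

text \<open>The position \<open>i\<close> is the supremum of the block of length \<open>\<omega>\<^bsup>j\<^esup>\<close> of all tuples with prefix \<open>us\<close>.\<close>

definition block_sup :: "nat \<Rightarrow> nat list \<Rightarrow> nat \<Rightarrow> nat list option \<Rightarrow> bool" where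
  "block_sup n us j i \<longleftrightarrow> length us + j = n \<and>
     (\<forall>zs. length zs = j \<longrightarrow> Some (us @ zs) \<in> underS (ord_succ (omega_pow n)) i) \<and>
     (\<forall>k \<in> underS (ord_succ (omega_pow n)) i.
        \<exists>p zs. k = Some p \<and> length zs = j \<and> (p, us @ zs) \<in> omega_pow n)"

lemma append_omega_pow_iff:
  "(us @ a, us @ b) \<in> omega_pow (length us + j) \<longleftrightarrow> (a, b) \<in> omega_pow j"
  by (induction us) (auto simp: omega_pow_Suc_iff dest: omega_pow_length)

lemma omega_pow_between_appends:
  assumes "(us @ a, k) \<in> omega_pow (length us + j)" "(k, us @ b) \<in> omega_pow (length us + j)"
  shows "\<exists>c. k = us @ c"
  using assms
proof (induction us arbitrary: k)
  case (Cons u us)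
  then obtain v k' where "k = v # k'"
    using omega_pow_length[OF Cons.prems(1)] by (cases k) auto
  then show ?case
    using Cons by (auto simp: omega_pow_Suc_iff)
qed simp

text \<open>If \<open>k\<close> is already smaller within the prefix, every point of the preceding
  block bounds it. Otherwise minimality of the zero tuple forces its next entry to be at most
  \<open>c\<close>.\<close>

lemma below_decomposed:
  assumes "(k, ys @ Suc c # replicate j 0) \<in> omega_pow (length ys + Suc j)"
    "k \<noteq> ys @ Suc c # replicate j 0"
  shows "\<exists>zs. length zs = j \<and> (k, ys @ c # zs) \<in> omega_pow (length ys + Suc j)"
  using assms
proof (induction ys arbitrary: k)
  case Nil
  then obtain a k' where k: "k = a # k'"
    using omega_pow_length[OF Nil.prems(1)] by (cases k) auto
  have "\<not> (a = Suc c \<and> (k', replicate j 0) \<in> omega_pow j)"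
    using Nil.prems k zeros_least[of k' j] omega_pow_antisym[of k' "replicate j 0" j]
      omega_pow_length[of k' "replicate j 0" j] by auto
  then have "a \<le> c" "length k' = j"
    using Nil.prems k by (auto simp: omega_pow_Suc_iff)
  then show ?case
    unfolding k by (intro exI[of _ k']) (auto simp: omega_pow_Suc_iff omega_pow_refl)
next
  case (Cons y ys)
  then obtain a k' where k: "k = a # k'"
    using omega_pow_length[OF Cons.prems(1)] by (cases k) auto
  show ?case
  proof (cases "a = y")
    case True
    then show ?thesis
      using Cons.IH[of k'] Cons.prems unfolding k
      by (auto simp: omega_pow_Suc_iff dest: omega_pow_length)
  next
    case False
    then show ?thesis
      using Cons.prems unfolding k
      by (intro exI[of _ "replicate j 0"]) (auto simp: omega_pow_Suc_iff)
  qed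
qed

lemma successor_least:
  assumes "(ys @ [c], k) \<in> omega_pow (Suc (length ys))" "k \<noteq> ys @ [c]"
  shows "(ys @ [Suc c], k) \<in> omega_pow (Suc (length ys))"
  using assms
proof (induction ys arbitrary: k)
  case Nil
  then show ?case
    using omega_pow_length[OF Nil.prems(1)]
    by (cases k) (auto simp: omega_pow_Suc_iff omega_pow_0)
next
  case (Cons y ys)
  then show ?case
    using omega_pow_length[OF Cons.prems(1)] by (cases k) (auto simp: omega_pow_Suc_iff)
qed

lemma block_sup_None: "block_sup n [] n None"
  by (auto simp: block_sup_def underS_ord_succ Field_omega_pow omega_pow_refl)

text \<open>The case \<open>j = 0\<close> is included: the block is then the single position
  \<open>ys @ [c]\<close>, and the supremum is the next position.\<close>

lemma block_sup_decomposed: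
  assumes n: "n = length ys + Suc j"
  shows "block_sup n (ys @ [c]) j (Some (ys @ Suc c # replicate j 0))"
proof -
  have "(ys @ c # zs, ys @ Suc c # replicate j 0) \<in> omega_pow n" if "length zs = j" for zs
    using append_omega_pow_iff[of ys "c # zs" "Suc c # replicate j 0" "Suc j"] that n
    by (simp add: omega_pow_Suc_iff)
  moreover have "\<exists>zs. length zs = j \<and> (p, ys @ c # zs) \<in> omega_pow n"
    if "p \<in> underS (omega_pow n) (ys @ Suc c # replicate j 0)" for p
    using that below_decomposed[of p ys c j] n by (auto simp: underS_def)
  ultimately show ?thesis
    using n unfolding block_sup_def underS_ord_succ by (auto simp: underS_def)
qed

text \<open>Points of a later subblock exceed all points of earlier ones, so occurring cofinally
  below \<open>i\<close> means occurring in subblocks of arbitrarily large index.\<close>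

lemma Inf_states_block_sup:
  assumes "block_sup n us (Suc m) i" "\<And>p. x (Some p) = f p"
  shows "Inf_states (ord_succ (omega_pow n)) x i =
    {q. infinite {a. \<exists>zs. length zs = m \<and> f (us @ a # zs) = q}}"
proof -
  have n: "n = length us + Suc m"
    and below: "\<And>zs. length zs = Suc m \<Longrightarrow> Some (us @ zs) \<in> underS (ord_succ (omega_pow n)) i"
    and cofinal: "\<And>k. k \<in> underS (ord_succ (omega_pow n)) i \<Longrightarrow>
      \<exists>p zs. k = Some p \<and> length zs = Suc m \<and> (p, us @ zs) \<in> omega_pow n"
    using assms(1) by (auto simp: block_sup_def)
  have mono: "(us @ a # xs, us @ b # ys) \<in> omega_pow n \<longleftrightarrow> (a # xs, b # ys) \<in> omega_pow (Suc m)"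
    for a b xs ys
    using append_omega_pow_iff[of us "a # xs" "b # ys" "Suc m"] n by simp
  have "\<exists>b\<ge>a. \<exists>zs. length zs = m \<and> f (us @ b # zs) = q"
    if q: "q \<in> Inf_states (ord_succ (omega_pow n)) x i" for q a
  proof -
    have "Some (us @ a # replicate m 0) \<in> underS (ord_succ (omega_pow n)) i"
      by (simp add: below)
    then obtain k where k: "k \<in> underS (ord_succ (omega_pow n)) i"
      "(Some (us @ a # replicate m 0), k) \<in> ord_succ (omega_pow n)" "x k = q"
      using q unfolding Inf_states_def by blast
    then obtain p zs where p: "k = Some p" "length zs = Suc m" "(p, us @ zs) \<in> omega_pow n"
      using cofinal by blast
    \<comment> \<open>A point between two points of the block lies in the block.\<close>
    then obtain c where c: "p = us @ c"
      using omega_pow_between_appends[of us "a # replicate m 0" p "Suc m" zs] k(2) n by auto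
    then obtain b cs where bcs: "c = b # cs" "length cs = m"
      using omega_pow_length[OF p(3)] n by (cases c) auto
    then have "a \<le> b"
      using k(2) p(1) c mono by (auto simp: omega_pow_Suc_iff)
    then show ?thesis
      using bcs c p(1) k(3) assms(2) by auto
  qed
  moreover have "q \<in> Inf_states (ord_succ (omega_pow n)) x i"
    if q: "\<And>a. \<exists>b\<ge>a. \<exists>zs. length zs = m \<and> f (us @ b # zs) = q" for q
    unfolding Inf_states_def
  proof (intro CollectI ballI)
    fix j
    assume "j \<in> underS (ord_succ (omega_pow n)) i"
    then obtain p zs where p: "j = Some p" "length zs = Suc m" "(p, us @ zs) \<in> omega_pow n"
      using cofinal by blast
    then obtain a zs' where a: "zs = a # zs'" "length zs' = m"
      by (cases zs) auto
    \<comment> \<open>A strictly larger index dominates \<open>zs\<close> whatever the tails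
      are.\<close>
    obtain b cs where b: "b \<ge> Suc a" "length cs = m" "f (us @ b # cs) = q"
      using q by blast
    then have "(us @ zs, us @ b # cs) \<in> omega_pow n"
      using a mono by (auto simp: omega_pow_Suc_iff)
    then have "(p, us @ b # cs) \<in> omega_pow n"
      using p(3) omega_pow_trans by blast
    then show "\<exists>k\<in>underS (ord_succ (omega_pow n)) i. (j, k) \<in> ord_succ (omega_pow n) \<and> x k = q"
      using below[of "b # cs"] b p(1) assms(2) by (intro bexI[of _ "Some (us @ b # cs)"]) auto
  qed
  ultimately show ?thesis
    by (auto simp: infinite_nat_iff_unbounded_le)
qed

section \<open>The automaton, its run and its language\<close>

text \<open>The letters in \<open>D\<close> mark positions. A successor step forgets the old state
  because the block just completed is a single letter; the final state \<open>2 * n\<close> reports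
  that the marked set is not full.\<close>

definition fullness_automaton :: "nat \<Rightarrow> 'a set \<Rightarrow> 'a set \<Rightarrow> ('a, nat) ord_automaton" where
  "fullness_automaton n \<Sigma> D =
    \<lparr> alphabet = \<Sigma>,
      states = {..2 * n + 1},
      initial = 0,
      trans_succ = {(q, a, of_bool (a \<in> D)) | q a. q \<le> 2 * n + 1 \<and> a \<in> \<Sigma>},
      trans_lim = {(S, Max S + 2) | S. S \<noteq> {} \<and> S \<subseteq> {..2 * n + 1} \<and> Max S + 2 \<le> 2 * n + 1},
      final = {2 * n} \<rparr>"

lemma is_ord_automaton_fullness: "finite \<Sigma> \<Longrightarrow> is_ord_automaton (fullness_automaton n \<Sigma> D)"
  by (auto simp: is_ord_automaton_def fullness_automaton_def)

definition fullness_run :: "nat \<Rightarrow> nat list set \<Rightarrow> nat list option \<Rightarrow> nat" where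
  "fullness_run n P i =
    (case i of None \<Rightarrow> 2 * n + of_bool (full n P) | Some p \<Rightarrow> state_at P p)"

lemma fullness_run_limit:
  assumes block: "block_sup n us (Suc m) i"
    and val: "fullness_run n P i = 2 * Suc m + of_bool (full (Suc m) {zs. us @ zs \<in> P})"
  shows "(Inf_states (ord_succ (omega_pow n)) (fullness_run n P) i, fullness_run n P i)
    \<in> trans_lim (fullness_automaton n \<Sigma> D)"
proof -
  let ?T = "Inf_states (ord_succ (omega_pow n)) (fullness_run n P) i"
  have T: "?T = {q. infinite {a. \<exists>zs. length zs = m \<and> state_at P (us @ a # zs) = q}}"
    by (rule Inf_states_block_sup[OF block]) (simp add: fullness_run_def)
  have "Suc m \<le> n"
    using block by (simp add: block_sup_def)
  then show ?thesis
    using block_states[where m = m and P = P and us = us] val unfolding T[symmetric] fullness_automaton_def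
    by (auto intro!: exI[of _ ?T]) (force simp: of_bool_def)+
qed

lemma is_run_fullness_run:
  assumes n: "1 \<le> n" and w: "w \<in> words (omega_pow n) \<Sigma>"
  shows "is_run (omega_pow n) (fullness_automaton n \<Sigma> D) w
    (fullness_run n {p \<in> Field (omega_pow n). w p \<in> D})"
proof -
  define P where "P = {p \<in> Field (omega_pow n). w p \<in> D}"
  let ?A = "fullness_automaton n \<Sigma> D" and ?x = "fullness_run n P" and ?R = "ord_succ (omega_pow n)"
  have bound: "?x i \<le> 2 * n + 1" if "i \<in> Field ?R" for i
  proof (cases i)
    case (Some p)
    then have "length p = n"
      using that by (auto simp: Field_ord_succ Field_omega_pow)
    then show ?thesis
      using state_at_less[of p P] n Some by (cases p) (auto simp: fullness_run_def)
  qed (simp add: fullness_run_def)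
  have zero: "?x i = 0" if "is_zero ?R i" for i
  proof (cases i)
    case None
    then show ?thesis
      using that Ex_list_of_length[of n] by (auto simp: is_zero_def underS_ord_succ Field_omega_pow)
  next
    case (Some p)
    then have "length p = n" "underS (omega_pow n) p = {}"
      using that by (auto simp: is_zero_def underS_ord_succ Field_ord_succ Field_omega_pow)
    then have "(replicate n 0, p) \<in> omega_pow n" "replicate n 0 \<notin> underS (omega_pow n) p"
      using zeros_least[of p n] by simp_all
    then have "p = replicate n 0"
      by (simp add: underS_def)
    then show ?thesis
      using Some by (simp add: fullness_run_def state_at_zeros)
  qed
  \<comment> \<open>As \<open>n\<close> is positive, \<open>p\<close> has a last entry
    \<open>c\<close>. The tuple \<open>ys @ [Suc c]\<close> is at most \<open>i\<close>, and not
    below it since \<open>p\<close> is the greatest position below \<open>i\<close>.\<close>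
  have succ_form: "\<exists>ys c. p = ys @ [c] \<and> n = Suc (length ys) \<and> i = Some (ys @ [Suc c])"
    if succ: "is_succ_of ?R i (Some p)" for i p
  proof -
    have p: "Some p \<in> underS ?R i" and greatest: "\<And>k. k \<in> underS ?R i \<Longrightarrow> (k, Some p) \<in> ?R"
      using succ by (auto simp: is_succ_of_def)
    have "length p = n"
      using p unfolding underS_def by (cases i) (auto simp: Field_omega_pow dest: omega_pow_length)
    then obtain ys c where ys: "p = ys @ [c]" "n = Suc (length ys)"
      using n by (cases p rule: rev_cases) auto
    let ?s = "ys @ [Suc c]"
    have not_below: "Some ?s \<notin> underS ?R i"
    proof
      assume "Some ?s \<in> underS ?R i"
      then have "(?s, p) \<in> omega_pow n"
        using greatest by fastforce
      then show False
        using append_omega_pow_iff[of ys "[Suc c]" "[c]" 1] ys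
        by (simp add: omega_pow_Suc_iff omega_pow_0)
    qed
    then obtain k where k: "i = Some k"
      using ys by (cases i) (auto simp: underS_ord_succ Field_omega_pow)
    then have "(?s, k) \<in> omega_pow n"
      using successor_least[of ys c k] p ys by (auto simp: underS_def)
    then show ?thesis
      using not_below k ys by (auto simp: underS_def)
  qed
  have succ: "(?x (Some p), w p, ?x i) \<in> trans_succ ?A" if i: "is_succ_of ?R i (Some p)" for i p
  proof -
    obtain ys c where ys: "p = ys @ [c]" "n = Suc (length ys)" "i = Some (ys @ [Suc c])"
      using succ_form[OF i] by blast
    then have p: "p \<in> Field (omega_pow n)"
      by (simp add: Field_omega_pow)
    \<comment> \<open>The case \<open>j = 0\<close> of \<open>state_at_decomposed\<close>: fullness
      of a one-letter block is membership of its position in \<open>P\<close>.\<close>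
    have "?x i = of_bool (p \<in> P)"
      using state_at_decomposed[of P ys c 0] ys by (simp add: fullness_run_def)
    also have "\<dots> = of_bool (w p \<in> D)"
      using p by (simp add: P_def)
    finally have "?x i = of_bool (w p \<in> D)" .
    moreover have "w p \<in> \<Sigma>" "?x (Some p) \<le> 2 * n + 1"
      using w p bound by (auto simp: words_def Field_ord_succ)
    ultimately show ?thesis
      by (simp add: fullness_automaton_def)
  qed
  have limit: "(Inf_states ?R ?x i, ?x i) \<in> trans_lim ?A" if lim: "is_limit ?R i" for i
  proof (cases i)
    case None
    \<comment> \<open>The end of the word closes the block with empty prefix, and
      \<open>n = Suc m\<close> gives it subblocks.\<close>
    obtain m where m: "n = Suc m"
      using n by (cases n) auto
    show ?thesis
      using block_sup_None[of n] None m
      by (intro fullness_run_limit[of n "[]" m]) (simp_all add: fullness_run_def)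
  next
    case (Some p)
    have p: "length p = n"
      using lim Some by (auto simp: is_limit_def Field_ord_succ Field_omega_pow)
    show ?thesis
    proof (cases p rule: zeros_or_decomposed)
      case 1
      \<comment> \<open>The zero tuple is the first position, hence no limit.\<close>
      have "underS (omega_pow n) p = {}"
      proof -
        have False if "(k, p) \<in> omega_pow n" "k \<noteq> p" for k
          using omega_pow_antisym[OF that(1)] that omega_pow_length[OF that(1)] zeros_least[of k n] 1
          by metis
        then show ?thesis
          by (auto simp: underS_def)
      qed
      then show ?thesis
        using lim Some by (auto simp: is_limit_def is_zero_def underS_ord_succ)
    next
      case (2 ys c j)
      have block: "block_sup n (ys @ [c]) j i"
        using block_sup_decomposed[of n ys j c] 2 p Some by simp
      show ?thesis
      proof (cases j)
        case 0
        \<comment> \<open>A one-position block makes \<open>i\<close> a successor, which a limit is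
          not.\<close>
        have "is_succ_of ?R i (Some (ys @ [c]))"
          using block lim 0 unfolding is_succ_of_def block_sup_def is_limit_def by fastforce
        then show ?thesis
          using lim by (auto simp: is_limit_def)
      next
        case (Suc m)
        then show ?thesis
          using block 2 Some state_at_decomposed[of P ys c j]
          by (intro fullness_run_limit[of n "ys @ [c]" m]) (simp_all add: fullness_run_def)
      qed
    qed
  qed
  show ?thesis
    unfolding is_run_def P_def[symmetric]
    using bound zero succ limit by (auto simp: fullness_automaton_def)
qed

lemma language_fullness_automaton:
  assumes n: "1 \<le> n"
  shows "language (omega_pow n) (fullness_automaton n \<Sigma> D) =
    {w \<in> words (omega_pow n) \<Sigma>. \<not> full n {p \<in> Field (omega_pow n). w p \<in> D}}"
proof -
  let ?A = "fullness_automaton n \<Sigma> D"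
  have "accepts (omega_pow n) ?A w \<longleftrightarrow> \<not> full n {p \<in> Field (omega_pow n). w p \<in> D}"
    if w: "w \<in> words (omega_pow n) \<Sigma>" for w
  proof -
    let ?x = "fullness_run n {p \<in> Field (omega_pow n). w p \<in> D}"
    have run: "is_run (omega_pow n) ?A w ?x"
      by (rule is_run_fullness_run[OF n w])
    \<comment> \<open>Determinism carries the end state of the explicit run over to every
      run.\<close>
    have "y None = ?x None" if "is_run (omega_pow n) ?A w y" for y
      by (rule is_run_unique[OF Well_order_omega_pow that run]) (auto simp: fullness_automaton_def)
    then have "accepts (omega_pow n) ?A w \<longleftrightarrow> ?x None \<in> final ?A"
      unfolding accepts_def using run by metis
    then show ?thesis
      by (simp add: fullness_run_def fullness_automaton_def)
  qed
  moreover have "alphabet ?A = \<Sigma>"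
    by (simp add: fullness_automaton_def)
  ultimately show ?thesis
    unfolding language_def by auto
qed

section \<open>The quotient structure\<close>

lemma approx_omega_iff:
  assumes "A \<subseteq> Field (omega_pow n)" "B \<subseteq> Field (omega_pow n)"
  shows "(A, B) \<in> approx_omega n \<longleftrightarrow> \<not> full n (A - B) \<and> \<not> full n (B - A)"
proof -
  have "(A - B) \<union> (B - A) \<subseteq> Field (omega_pow n)"
    using assms by blast
  then show ?thesis
    using assms by (simp add: approx_omega_def I_omega_iff full_Un)
qed

lemma not_full_Diff_trans:
  assumes "\<not> full n (A - B)" "\<not> full n (B - C)"
  shows "\<not> full n (A - C)"
proof
  assume "full n (A - C)"
  then have "full n ((A - B) \<union> (B - C))"
    by (rule full_mono) blast
  then show False
    using assms by (simp add: full_Un)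
qed

lemma equiv_approx_omega: "equiv (Pow (Field (omega_pow n))) (approx_omega n)"
proof (rule equivI)
  show sub: "approx_omega n \<subseteq> Pow (Field (omega_pow n)) \<times> Pow (Field (omega_pow n))"
    by (auto simp: approx_omega_def)
  show "refl_on (Pow (Field (omega_pow n))) (approx_omega n)"
    by (auto simp: refl_on_def approx_omega_iff not_full_empty)
  show "sym (approx_omega n)"
    by (auto simp: sym_def approx_omega_def Un_commute)
  show "trans (approx_omega n)"
  proof (rule transI)
    fix A B C
    assume AB: "(A, B) \<in> approx_omega n" and BC: "(B, C) \<in> approx_omega n"
    then have "A \<subseteq> Field (omega_pow n)" "B \<subseteq> Field (omega_pow n)" "C \<subseteq> Field (omega_pow n)"
      by (auto simp: approx_omega_def)
    with AB BC show "(A, C) \<in> approx_omega n"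
      using not_full_Diff_trans[of n A B C] not_full_Diff_trans[of n C B A]
      by (simp add: approx_omega_iff)
  qed
qed

text \<open>\<open>almost_subset\<close> asks only for some representatives; chaining the non-full
  differences \<open>A - A'\<close>, \<open>A' - B'\<close> and \<open>B' - B\<close> makes the
  choice irrelevant.\<close>

lemma almost_subset_iff:
  assumes A: "A \<subseteq> Field (omega_pow n)" and B: "B \<subseteq> Field (omega_pow n)"
  shows "[approx_omega n `` {A}, approx_omega n `` {B}] \<in> almost_subset n \<longleftrightarrow> \<not> full n (A - B)"
proof
  assume "[approx_omega n `` {A}, approx_omega n `` {B}] \<in> almost_subset n"
  then obtain A' B' where eq: "approx_omega n `` {A} = approx_omega n `` {A'}"
    "approx_omega n `` {B} = approx_omega n `` {B'}"
    and sub: "A' \<subseteq> Field (omega_pow n)" "B' \<subseteq> Field (omega_pow n)" and I: "A' - B' \<in> I_omega n"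
    unfolding almost_subset_def by auto
  have "(A, A') \<in> approx_omega n" "(B, B') \<in> approx_omega n"
    using eq eq_equiv_class[OF _ equiv_approx_omega] sub by simp_all
  moreover have "\<not> full n (A' - B')"
    using I sub I_omega_iff[of "A' - B'" n] by blast
  ultimately show "\<not> full n (A - B)"
    using A B sub not_full_Diff_trans by (metis approx_omega_iff)
next
  assume "\<not> full n (A - B)"
  then have "A - B \<in> I_omega n"
    using A I_omega_iff[of "A - B" n] by blast
  then show "[approx_omega n `` {A}, approx_omega n `` {B}] \<in> almost_subset n"
    using A B unfolding almost_subset_def by blast
qed

section \<open>Words over pairs of letters\<close>

lemma finite_tuples: "finite \<Sigma> \<Longrightarrow> finite (tuples m \<Sigma>)"
  using finite_lists_length_eq[of \<Sigma> m] unfolding tuples_def by (simp add: conj_commute)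

lemma tuples_2_iff: "xs \<in> tuples 2 M \<longleftrightarrow> (\<exists>a\<in>M. \<exists>b\<in>M. xs = [a, b])"
  by (auto simp: tuples_def length_Suc_conv numeral_2_eq_2)

text \<open>A word over pairs is recovered from its two coordinate words; equality off the field
  holds because words are extensional.\<close>

lemma words_tuples_2_eq:
  "words r (tuples 2 \<Sigma>) = convolution r ` {[u, v] | u v. u \<in> words r \<Sigma> \<and> v \<in> words r \<Sigma>}"
proof (intro equalityI subsetI)
  fix w
  assume w: "w \<in> words r (tuples 2 \<Sigma>)"
  define u where "u = (\<lambda>p\<in>Field r. w p ! 0)"
  define v where "v = (\<lambda>p\<in>Field r. w p ! 1)"
  have wp: "\<exists>a\<in>\<Sigma>. \<exists>b\<in>\<Sigma>. w p = [a, b]" if "p \<in> Field r" for p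
    using w that tuples_2_iff unfolding words_def by blast
  have "u \<in> words r \<Sigma>" "v \<in> words r \<Sigma>"
    using wp unfolding words_def u_def v_def by fastforce+
  moreover have "w = convolution r [u, v]"
  proof
    fix p
    show "w p = convolution r [u, v] p"
      using wp[of p] w by (auto simp: convolution_def u_def v_def words_def PiE_def extensional_def)
  qed
  ultimately show "w \<in> convolution r ` {[u, v] | u v. u \<in> words r \<Sigma> \<and> v \<in> words r \<Sigma>}"
    by blast
next
  fix w
  assume "w \<in> convolution r ` {[u, v] | u v. u \<in> words r \<Sigma> \<and> v \<in> words r \<Sigma>}"
  then obtain u v where "w = convolution r [u, v]" "u \<in> words r \<Sigma>" "v \<in> words r \<Sigma>"
    by blast
  then show "w \<in> words r (tuples 2 \<Sigma>)"
    by (auto simp: convolution_def words_def tuples_2_iff)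
qed

text \<open>Marking pairs of letters makes the automaton test a set read off letterwise from two
  words.\<close>

lemma recognizes_fullness_automaton:
  assumes n: "1 \<le> n" and "finite \<Sigma>"
  shows "recognizes (omega_pow n) \<Sigma> 2 (fullness_automaton n (tuples 2 \<Sigma>) D)
    {[u, v] | u v. u \<in> words (omega_pow n) \<Sigma> \<and> v \<in> words (omega_pow n) \<Sigma> \<and>
       \<not> full n {p \<in> Field (omega_pow n). [u p, v p] \<in> D}}"
proof -
  let ?r = "omega_pow n"
  have "{p \<in> Field ?r. convolution ?r [u, v] p \<in> D} = {p \<in> Field ?r. [u p, v p] \<in> D}" for u v
    by (auto simp: convolution_def)
  then have "language ?r (fullness_automaton n (tuples 2 \<Sigma>) D) = convolution ?r `
    {[u, v] | u v. u \<in> words ?r \<Sigma> \<and> v \<in> words ?r \<Sigma> \<and> \<not> full n {p \<in> Field ?r. [u p, v p] \<in> D}}"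
    unfolding language_fullness_automaton[OF n] words_tuples_2_eq by (auto 0 4)
  moreover have "alphabet (fullness_automaton n (tuples 2 \<Sigma>) D) = tuples 2 \<Sigma>"
    by (simp add: fullness_automaton_def)
  ultimately show ?thesis
    unfolding recognizes_def
    using is_ord_automaton_fullness[OF finite_tuples[OF assms(2)], of n 2 D]
    by (auto simp: tuples_2_iff)
qed

text \<open>\<open>E\<close> is the kernel of \<open>h\<close>, so \<open>g\<close> is injective on
  classes. Tuples of classes are handled through chosen representatives, and compatibility of
  \<open>R\<close> makes the choice harmless.\<close>

lemma quotient_isomorphism:
  assumes E: "equiv L E" and E_iff: "\<And>u v. u \<in> L \<Longrightarrow> v \<in> L \<Longrightarrow> (u, v) \<in> E \<longleftrightarrow> h u = h v"
    and surj: "h ` L = M"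
    and g: "\<And>w. w \<in> L \<Longrightarrow> g (E `` {w}) = h w"
    and R: "compatible E R"
    and S: "\<And>ws. ws \<in> tuples m L \<Longrightarrow> ws \<in> R \<longleftrightarrow> map h ws \<in> S"
  shows "is_isomorphism g
    (quotient_structure \<lparr> universe = L, relations = [(m, R)] \<rparr> E)
    \<lparr> universe = M, relations = [(m, S)] \<rparr>"
proof -
  have "bij_betw g (L // E) M"
    unfolding bij_betw_def
  proof
    show "inj_on g (L // E)"
    proof (rule inj_onI)
      fix X Y
      assume "X \<in> L // E" "Y \<in> L // E" "g X = g Y"
      then obtain u v where uv: "X = E `` {u}" "Y = E `` {v}" "u \<in> L" "v \<in> L" "h u = h v"
        using g by (metis quotientE)
      then show "X = Y"
        using E_iff equiv_class_eq[OF E] by simp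
    qed
    show "g ` (L // E) = M"
      using g surj unfolding quotient_def by (auto simp: image_iff)
  qed
  moreover have "Xs \<in> map (\<lambda>w. E `` {w}) ` R \<longleftrightarrow> map g Xs \<in> S" if Xs: "Xs \<in> tuples m (L // E)" for Xs
  proof -
    have "\<forall>X\<in>set Xs. \<exists>w\<in>L. X = E `` {w}"
      using Xs unfolding tuples_def quotient_def by blast
    then obtain c where c: "\<And>X. X \<in> set Xs \<Longrightarrow> c X \<in> L \<and> X = E `` {c X}"
      by metis
    define ws where "ws = map c Xs"
    have ws: "ws \<in> tuples m L"
      using Xs c by (auto simp: ws_def tuples_def)
    have Xs_eq: "Xs = map (\<lambda>w. E `` {w}) ws"
      unfolding ws_def map_map comp_def using c by (simp add: map_idI)
    have "Xs \<in> map (\<lambda>w. E `` {w}) ` R \<longleftrightarrow> ws \<in> R"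
    proof
      assume "Xs \<in> map (\<lambda>w. E `` {w}) ` R"
      then obtain vs where vs: "vs \<in> R" "map (\<lambda>w. E `` {w}) vs = map (\<lambda>w. E `` {w}) ws"
        using Xs_eq by auto
      have "list_all2 (\<lambda>x y. E `` {x} = E `` {y}) vs ws"
        using vs(2) by (simp add: list.rel_eq[symmetric] list.rel_map)
      then have "list_all2 (\<lambda>x y. (x, y) \<in> E) vs ws"
      proof (rule list.rel_mono_strong)
        fix x y
        assume "y \<in> set ws" "E `` {x} = E `` {y}"
        then show "(x, y) \<in> E"
          using eq_equiv_class[OF _ E] ws by (auto simp: tuples_def)
      qed
      then show "ws \<in> R"
        using vs(1) R unfolding compatible_def by blast
    qed (use Xs_eq in blast)
    moreover have "map g Xs = map h ws"
      unfolding Xs_eq using g ws by (auto simp: tuples_def)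
    ultimately show ?thesis
      using S[OF ws] by simp
  qed
  ultimately show ?thesis
    by (simp add: is_isomorphism_def quotient_structure_def)
qed

section \<open>The automatic presentation by characteristic words\<close>

theorem theorem4p3:
  fixes n :: nat
  assumes "1 \<le> n"
  shows "omega_pow_automatic n (power_quotient n)"
proof -
  let ?r = "omega_pow n" and ?\<Sigma> = "{0, 1 :: nat}"
  let ?L = "words ?r ?\<Sigma>"
  \<comment> \<open>With no letter marked, the marked set is empty and so not full: every word is
    accepted.\<close>
  define A where "A = fullness_automaton n ?\<Sigma> {}"
  define supp :: "(nat list \<Rightarrow> nat) \<Rightarrow> nat list set" where "supp w = {p \<in> Field ?r. w p = 1}" for w
  define h where "h w = approx_omega n `` {supp w}" for w
  define E where "E = {(u, v). u \<in> ?L \<and> v \<in> ?L \<and> h u = h v}"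
  define R where "R = {[u, v] | u v. u \<in> ?L \<and> v \<in> ?L \<and> \<not> full n (supp u - supp v)}"
  \<comment> \<open>Any representative serves, since \<open>h\<close> is constant on the classes of
    \<open>E\<close>.\<close>
  define g where "g X = h (SOME w. w \<in> X)" for X
  \<comment> \<open>The letter \<open>[1, 0]\<close> marks \<open>supp u - supp v\<close>; together
    with \<open>[0, 1]\<close> it marks the symmetric difference.\<close>
  let ?A_eq = "fullness_automaton n (tuples 2 ?\<Sigma>) {[0, 1], [1, 0]}"
  let ?A_sub = "fullness_automaton n (tuples 2 ?\<Sigma>) {[1, 0]}"
  have fin: "finite ?\<Sigma>"
    by simp
  have supp: "supp w \<subseteq> Field ?r" for w
    by (auto simp: supp_def)
  have L: "language ?r A = ?L"
    unfolding A_def language_fullness_automaton[OF assms] by (simp add: not_full_empty)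
  have alph: "alphabet A = ?\<Sigma>"
    by (simp add: A_def fullness_automaton_def)
  have equiv_E: "equiv ?L E"
    by (rule equivI) (auto simp: E_def refl_on_def sym_def trans_def)
  have h_eq: "h u = h v \<longleftrightarrow> \<not> full n (supp u - supp v) \<and> \<not> full n (supp v - supp u)" for u v
    unfolding h_def using eq_equiv_class_iff[OF equiv_approx_omega] supp approx_omega_iff
    by (metis PowI)
  have letters: "w p = 0 \<or> w p = 1" if "w \<in> ?L" "p \<in> Field ?r" for w p
    using that unfolding words_def by fastforce
  have diff: "{p \<in> Field ?r. [u p, v p] \<in> {[1, 0]}} = supp u - supp v"
    "{p \<in> Field ?r. [u p, v p] \<in> {[0, 1], [1, 0]}} = (supp u - supp v) \<union> (supp v - supp u)"
    if "u \<in> ?L" "v \<in> ?L" for u v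
    using letters[OF that(1)] letters[OF that(2)] unfolding supp_def by fastforce+
  have E_rel: "{[u, v] | u v. (u, v) \<in> E} =
    {[u, v] | u v. u \<in> ?L \<and> v \<in> ?L \<and> \<not> full n {p \<in> Field ?r. [u p, v p] \<in> {[0, 1], [1, 0]}}}"
    using diff(2) unfolding E_def h_eq
    by (smt (verit, best) Collect_cong case_prod_conv full_Un mem_Collect_eq)
  have R_eq: "R = {[u, v] | u v. u \<in> ?L \<and> v \<in> ?L \<and> \<not> full n {p \<in> Field ?r. [u p, v p] \<in> {[1, 0]}}}"
    using diff(1) unfolding R_def by (smt (verit, best) Collect_cong)
  have rec_eq: "recognizes ?r ?\<Sigma> 2 ?A_eq {[u, v] | u v. (u, v) \<in> E}"
    unfolding E_rel by (rule recognizes_fullness_automaton[OF assms fin])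
  have rec_sub: "recognizes ?r ?\<Sigma> 2 ?A_sub R"
    unfolding R_eq by (rule recognizes_fullness_automaton[OF assms fin])
  have R_tuples: "R \<subseteq> tuples 2 ?L"
    by (auto simp: R_def tuples_2_iff)
  have R_iff: "[u, v] \<in> R \<longleftrightarrow> [h u, h v] \<in> almost_subset n" if "u \<in> ?L" "v \<in> ?L" for u v
    using that almost_subset_iff[OF supp supp] by (simp add: R_def h_def)
  have compat: "compatible E R"
    unfolding compatible_def
  proof (intro allI impI; elim conjE)
    fix us vs
    assume us: "us \<in> R" and E_us: "list_all2 (\<lambda>x y. (x, y) \<in> E) us vs"
    obtain u1 u2 where u: "us = [u1, u2]" "u1 \<in> ?L" "u2 \<in> ?L"
      using us by (auto simp: R_def)
    then obtain v1 v2 where v: "vs = [v1, v2]" "(u1, v1) \<in> E" "(u2, v2) \<in> E"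
      using E_us by (auto simp: list_all2_Cons1)
    then show "vs \<in> R"
      using us u R_iff by (simp add: E_def)
  qed
  have h_onto: "h ` ?L = Pow (Field ?r) // approx_omega n"
  proof (intro equalityI subsetI)
    fix X
    assume "X \<in> Pow (Field ?r) // approx_omega n"
    then obtain B where B: "B \<subseteq> Field ?r" "X = approx_omega n `` {B}"
      by (auto elim: quotientE)
    \<comment> \<open>The characteristic word of the representative \<open>B\<close> is a code for
      the class \<open>X\<close>.\<close>
    define w :: "nat list \<Rightarrow> nat" where "w = (\<lambda>p\<in>Field ?r. of_bool (p \<in> B))"
    have "w \<in> ?L" "supp w = B"
      using B(1) by (auto simp: w_def words_def supp_def)
    then show "X \<in> h ` ?L"
      using B(2) by (auto simp: h_def)
  qed (use supp in \<open>auto simp: h_def intro!: quotientI\<close>)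
  have g: "g (E `` {w}) = h w" if "w \<in> ?L" for w
  proof -
    have "w \<in> E `` {w}"
      using that by (simp add: E_def)
    then have some: "(SOME v. v \<in> E `` {w}) \<in> E `` {w}"
      by (rule someI[of "\<lambda>v. v \<in> E `` {w}"])
    have "h v = h w" if "v \<in> E `` {w}" for v
      using that by (simp add: E_def)
    from this[OF some] show ?thesis
      unfolding g_def .
  qed
  have "is_isomorphism g (quotient_structure \<lparr> universe = ?L, relations = [(2, R)] \<rparr> E)
    (power_quotient n)"
    unfolding power_quotient_def
  proof (rule quotient_isomorphism[OF equiv_E _ h_onto g compat])
    show "ws \<in> R \<longleftrightarrow> map h ws \<in> almost_subset n" if "ws \<in> tuples 2 ?L" for ws
      using that R_iff by (auto simp: tuples_2_iff)
  qed (simp_all add: E_def)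
  moreover have "is_structure (power_quotient n)"
    by (auto simp: is_structure_def power_quotient_def almost_subset_def tuples_2_iff intro!: quotientI)
  moreover have "is_structure \<lparr> universe = ?L, relations = [(2, R)] \<rparr>"
    using R_tuples by (simp add: is_structure_def)
  moreover have "is_ord_automaton A"
    unfolding A_def by (rule is_ord_automaton_fullness[OF fin])
  moreover have "universe (power_quotient n) = Pow (Field ?r) // approx_omega n"
    by (simp add: power_quotient_def)
  ultimately show ?thesis
    unfolding omega_pow_automatic_def automatic_def
    using h_onto equiv_E rec_eq rec_sub compat g
    by (intro conjI exI[of _ A] exI[of _ ?A_eq] exI[of _ "[?A_sub]"] exI[of _ h] exI[of _ E]
        exI[of _ "[(2, R)]"] exI[of _ g]) (simp_all add: L alph)
qed

end
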